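(* Let $P_{2n}$ be the path on $2n\geq 4$ vertices with adjacency matrix $A$ and endpoints $u,v$, and let $Q=\mathrm{diag}(Q_1,\dots,Q_n,Q_n,\dots,Q_1)$ be any symmetric real potential. Then perfect state transfer from $u$ to $v$ for the Hamiltonian $H = A - Q$ cannot occur, for any values of $Q_1,\dots,Q_n$.
   Context: With $U(t) = e^{itH}$, perfect state transfer from $u$ to $v$ occurs at time $T$ if $|U(T)_{u,v}|=1$; the claim is that there is no such $T$. *)

theory Defs
  imports Complex_Main "Jordan_Normal_Form.Matrix"
begin

definition path_adj :: "nat \<Rightarrow> real mat" where
  "path_adj N = mat N N (\<lambda>(i,j). if i + 1 = j \<or> j + 1 = i then 1 else 0)"

(* Symmetric (mirror-symmetric) potential Q = diag(Q_1,...,Q_n,Q_n,...,Q_1) on 2n vertices,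
   with Q_{k+1} = q k (0-based indexing). *)
definition sym_potential :: "nat \<Rightarrow> (nat \<Rightarrow> real) \<Rightarrow> real mat" where
  "sym_potential n q = mat (2*n) (2*n)
     (\<lambda>(i,j). if i = j then q (min i (2*n - 1 - i)) else 0)"

definition hamiltonian :: "nat \<Rightarrow> (nat \<Rightarrow> real) \<Rightarrow> real mat" where
  "hamiltonian n q = path_adj (2*n) - sym_potential n q"

definition evolution :: "real mat \<Rightarrow> real \<Rightarrow> complex mat" where
  "evolution H t = mat (dim_row H) (dim_col H)
     (\<lambda>(i,j). \<Sum>k. (\<i> * complex_of_real t) ^ k / of_nat (fact k)
                    * complex_of_real ((H ^\<^sub>m k) $$ (i,j)))"

definition PST :: "real mat \<Rightarrow> nat \<Rightarrow> nat \<Rightarrow> real \<Rightarrow> bool" where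
  "PST H u v T \<longleftrightarrow> cmod (evolution H T $$ (u,v)) = 1"

end

theory Submission
  imports Defs "HOL-Analysis.Complex_Transcendental" "HOL-Computational_Algebra.Fundamental_Theorem_Algebra"
begin

text \<open>Let \<open>P\<^sub>k\<close> be the characteristic polynomials of the initial segments of the path. The roots
  \<open>\<lambda>\<^sub>i\<close> of \<open>P\<^sub>n - P\<^bsub>n-1\<^esub>\<close> and \<open>\<mu>\<^sub>j\<close> of \<open>P\<^sub>n + P\<^bsub>n-1\<^esub>\<close> are the eigenvalues with mirror-symmetric
  and mirror-antisymmetric eigenvectors. If \<open>U(T)\<close> transfers one end to the other with phase \<open>\<gamma>\<close>,
  these eigenvectors give \<open>exp (iT\<lambda>\<^sub>i) = \<gamma>\<close> and \<open>exp (iT\<mu>\<^sub>j) = - \<gamma>\<close>, so every \<open>\<lambda>\<^sub>i - \<mu>\<^sub>j\<close> is an odd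
  multiple of \<open>c = \<pi>/T\<close>. Comparing second-highest coefficients, \<open>\<Sum>\<lambda>\<^sub>i - \<Sum>\<mu>\<^sub>j = 2\<close>, so \<open>2 = ck\<close> for
  an integer \<open>k\<close>. A resultant computation gives \<open>\<Prod>(\<lambda>\<^sub>i - \<mu>\<^sub>j) = \<plusminus>2\<^sup>n\<close> over all pairs. Hence
  \<open>2^(n\<^sup>2)\<close> times an odd number equals \<open>\<plusminus>2\<^sup>n k^(n\<^sup>2)\<close>, and the exponents of 2 force \<open>n\<close> to divide 1.\<close>

section \<open>The evolution operator\<close>

lemma pow_mat_add:
  assumes "A \<in> carrier_mat N N"
  shows "A ^\<^sub>m (k + l) = A ^\<^sub>m k * A ^\<^sub>m l"
proof (induction l)
  case 0
  then show ?case using assms by (simp add: right_mult_one_mat[OF pow_carrier_mat[OF assms]])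
next
  case (Suc l)
  then show ?case
    using assoc_mult_mat[OF pow_carrier_mat[OF assms] pow_carrier_mat[OF assms] assms] by simp
qed

lemma index_mult_mat_sum:
  assumes "A \<in> carrier_mat N N" "B \<in> carrier_mat N N" "i < N" "j < N"
  shows "(A * B) $$ (i,j) = (\<Sum>l<N. A $$ (i,l) * B $$ (l,j))"
  using assms by (auto simp: scalar_prod_def lessThan_atLeast0)

lemma pow_mat_symmetric:
  assumes A: "A \<in> carrier_mat N N" and sym: "\<And>i j. i < N \<Longrightarrow> j < N \<Longrightarrow> A $$ (i,j) = A $$ (j,i)"
    and "i < N" "j < N"
  shows "(A ^\<^sub>m k) $$ (i,j) = ((A ^\<^sub>m k) $$ (j,i) :: real)"
  using assms(3,4)
proof (induction k arbitrary: i j)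
  case 0
  then show ?case using A by auto
next
  case (Suc k)
  have "A ^\<^sub>m Suc k = A ^\<^sub>m (1 + k)" by simp
  also have "\<dots> = A * A ^\<^sub>m k"
    using pow_mat_add[OF A, of 1 k] A by simp
  finally have "(A ^\<^sub>m Suc k) $$ (i,j) = (\<Sum>l<N. A $$ (i,l) * (A ^\<^sub>m k) $$ (l,j))"
    using Suc.prems by (simp only: index_mult_mat_sum[OF A pow_carrier_mat[OF A]])
  also have "\<dots> = (\<Sum>l<N. (A ^\<^sub>m k) $$ (j,l) * A $$ (l,i))"
  proof (rule sum.cong[OF refl])
    fix l assume "l \<in> {..<N}"
    then show "A $$ (i,l) * (A ^\<^sub>m k) $$ (l,j) = (A ^\<^sub>m k) $$ (j,l) * A $$ (l,i)"
      using Suc.IH[of l j] sym[of i l] Suc.prems by simp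
  qed
  also have "\<dots> = (A ^\<^sub>m Suc k) $$ (j,i)"
    using Suc.prems by (simp add: index_mult_mat_sum[OF pow_carrier_mat[OF A] A])
  finally show ?case .
qed

text \<open>With \<open>D\<close> the sum of all absolute entries, each further factor
  \<open>A\<close> costs at most \<open>N * D\<close>. Such geometric growth lets the exponential
  series dominate the series of the evolution.\<close>

lemma pow_mat_entry_bound:
  assumes A: "(A :: real mat) \<in> carrier_mat N N"
  obtains C where "\<And>k i j. i < N \<Longrightarrow> j < N \<Longrightarrow> \<bar>(A ^\<^sub>m k) $$ (i,j)\<bar> \<le> C ^ k"
proof -
  define D where "D = (\<Sum>i<N. \<Sum>j<N. \<bar>A $$ (i,j)\<bar>)"
  have D: "\<bar>A $$ (i,j)\<bar> \<le> D" if "i < N" "j < N" for i j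
  proof -
    have "\<bar>A $$ (i,j)\<bar> \<le> (\<Sum>j<N. \<bar>A $$ (i,j)\<bar>)"
      using that by (intro member_le_sum) auto
    also have "\<dots> \<le> D" unfolding D_def
      using that by (intro member_le_sum[where f = "\<lambda>i. \<Sum>j<N. \<bar>A $$ (i,j)\<bar>"]) (auto intro: sum_nonneg)
    finally show ?thesis .
  qed
  have "D \<ge> 0" unfolding D_def by (intro sum_nonneg) auto
  have "\<bar>(A ^\<^sub>m k) $$ (i,j)\<bar> \<le> (real N * D) ^ k" if "i < N" "j < N" for k i j
    using that
  proof (induction k arbitrary: i j)
    case 0
    then show ?case using A by auto
  next
    case (Suc k)
    have "(A ^\<^sub>m Suc k) $$ (i,j) = (\<Sum>l<N. (A ^\<^sub>m k) $$ (i,l) * A $$ (l,j))"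
      using Suc.prems by (simp add: index_mult_mat_sum[OF pow_carrier_mat[OF A] A])
    also have "\<bar>\<dots>\<bar> \<le> (\<Sum>l<N. \<bar>(A ^\<^sub>m k) $$ (i,l)\<bar> * \<bar>A $$ (l,j)\<bar>)"
      by (rule order_trans[OF sum_abs]) (simp add: abs_mult)
    also have "\<dots> \<le> (\<Sum>l<N. (real N * D) ^ k * D)"
      using Suc D \<open>D \<ge> 0\<close> by (intro sum_mono mult_mono) auto
    also have "\<dots> = (real N * D) ^ Suc k" by simp
    finally show ?case .
  qed
  then show thesis by (rule that)
qed

text \<open>Stated for every complex \<open>z\<close> since unitarity needs both \<open>it\<close>
  and \<open>-it\<close>; the Cauchy product there requires absolute convergence.\<close>

lemma summable_norm_evolution:
  assumes A: "(A :: real mat) \<in> carrier_mat N N" and "i < N" "j < N"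
  shows "summable (\<lambda>k. norm (z ^ k / of_nat (fact k) * complex_of_real ((A ^\<^sub>m k) $$ (i,j))))"
proof -
  obtain C where C: "\<And>k i j. i < N \<Longrightarrow> j < N \<Longrightarrow> \<bar>(A ^\<^sub>m k) $$ (i,j)\<bar> \<le> C ^ k"
    using pow_mat_entry_bound[OF A] by blast
  show ?thesis
  proof (rule summable_comparison_test)
    show "summable (\<lambda>k. inverse (fact k) * (cmod z * C) ^ k)"
      by (rule summable_exp)
    have "norm (norm (z ^ k / of_nat (fact k) * complex_of_real ((A ^\<^sub>m k) $$ (i,j))))
        \<le> inverse (fact k) * (cmod z * C) ^ k" for k
      using mult_left_mono[OF C[OF assms(2,3), of k], of "cmod z ^ k / fact k"]
      by (simp add: norm_mult norm_divide norm_power power_mult_distrib field_simps)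
    then show "\<exists>M. \<forall>k\<ge>M. norm (norm (z ^ k / of_nat (fact k) * complex_of_real ((A ^\<^sub>m k) $$ (i,j))))
        \<le> inverse (fact k) * (cmod z * C) ^ k"
      by blast
  qed
qed

text \<open>The infinite sum in \<open>evolution\<close> has a meaningful value only when it
  converges; this supplies the convergence.\<close>

lemma evolution_sums:
  assumes "A \<in> carrier_mat N N" "i < N" "j < N"
  shows "(\<lambda>k. (\<i> * complex_of_real t) ^ k / of_nat (fact k) * complex_of_real ((A ^\<^sub>m k) $$ (i,j)))
    sums (evolution A t $$ (i,j))"
  using summable_sums[OF summable_norm_cancel[OF summable_norm_evolution[OF assms]]] assms
  by (simp add: evolution_def)

text \<open>The eigenvalue may be any complex number, so roots of complex polynomials can be
  inserted without first showing them real.\<close>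

lemma pow_mat_eigenvector:
  assumes A: "(A :: real mat) \<in> carrier_mat N N"
    and eig: "\<And>i. i < N \<Longrightarrow> (\<Sum>j<N. complex_of_real (A $$ (i,j)) * v j) = x * v i"
    and "i < N"
  shows "(\<Sum>j<N. complex_of_real ((A ^\<^sub>m k) $$ (i,j)) * v j) = x ^ k * v i"
proof (induction k)
  case 0
  have "(\<Sum>j<N. complex_of_real ((A ^\<^sub>m 0) $$ (i,j)) * v j) = (\<Sum>j<N. if i = j then v j else 0)"
    using A \<open>i < N\<close> by (intro sum.cong) auto
  then show ?case using \<open>i < N\<close> by simp
next
  case (Suc k)
  have "(\<Sum>j<N. complex_of_real ((A ^\<^sub>m Suc k) $$ (i,j)) * v j)
      = (\<Sum>j<N. \<Sum>l<N. complex_of_real ((A ^\<^sub>m k) $$ (i,l)) * (complex_of_real (A $$ (l,j)) * v j))"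
    using \<open>i < N\<close>
    by (intro sum.cong) (simp_all add: index_mult_mat_sum[OF pow_carrier_mat[OF A] A] sum_distrib_right mult.assoc)
  also have "\<dots> = (\<Sum>l<N. complex_of_real ((A ^\<^sub>m k) $$ (i,l)) * (x * v l))"
    by (subst sum.swap) (simp add: sum_distrib_left[symmetric] eig)
  also have "\<dots> = x * (\<Sum>l<N. complex_of_real ((A ^\<^sub>m k) $$ (i,l)) * v l)"
    by (simp add: sum_distrib_left mult_ac)
  finally show ?case using Suc by simp
qed

lemma evolution_eigenvector:
  assumes A: "A \<in> carrier_mat N N"
    and eig: "\<And>i. i < N \<Longrightarrow> (\<Sum>j<N. complex_of_real (A $$ (i,j)) * v j) = x * v i"
    and i: "i < N"
  shows "(\<Sum>j<N. evolution A t $$ (i,j) * v j) = exp (\<i> * complex_of_real t * x) * v i"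
proof -
  let ?a = "\<i> * complex_of_real t"
  have "(\<lambda>k. \<Sum>j<N. ?a ^ k / of_nat (fact k) * complex_of_real ((A ^\<^sub>m k) $$ (i,j)) * v j)
      sums (\<Sum>j<N. evolution A t $$ (i,j) * v j)"
    by (intro sums_sum sums_mult2 evolution_sums[OF A i]) auto
  moreover have "(\<Sum>j<N. ?a ^ k / of_nat (fact k) * complex_of_real ((A ^\<^sub>m k) $$ (i,j)) * v j)
      = (?a * x) ^ k /\<^sub>R fact k * v i" for k
  proof -
    have "(\<Sum>j<N. ?a ^ k / of_nat (fact k) * complex_of_real ((A ^\<^sub>m k) $$ (i,j)) * v j)
      = ?a ^ k / of_nat (fact k) * (\<Sum>j<N. complex_of_real ((A ^\<^sub>m k) $$ (i,j)) * v j)"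
      by (simp only: sum_distrib_left mult.assoc)
    also have "\<dots> = ?a ^ k / of_nat (fact k) * (x ^ k * v i)"
      by (simp only: pow_mat_eigenvector[OF A eig i])
    finally show ?thesis
      by (simp add: scaleR_conv_of_real power_mult_distrib field_simps)
  qed
  ultimately have "(\<lambda>k. (?a * x) ^ k /\<^sub>R fact k * v i) sums (\<Sum>j<N. evolution A t $$ (i,j) * v j)"
    by simp
  moreover have "(\<lambda>k. (?a * x) ^ k /\<^sub>R fact k * v i) sums (exp (?a * x) * v i)"
    by (intro sums_mult2 exp_converges)
  ultimately show ?thesis by (rule sums_unique2)
qed

text \<open>Unitarity read off the series: multiply the series of each entry by its conjugate and
  sum along the row. The terms of order \<open>k\<close> add up to
  \<open>(a + - a) ^ k / fact k\<close> times a diagonal entry of the \<open>k\<close>-th power,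
  which vanishes for \<open>k > 0\<close>.\<close>

lemma evolution_row_norm:
  assumes A: "A \<in> carrier_mat N N" and sym: "\<And>i j. i < N \<Longrightarrow> j < N \<Longrightarrow> A $$ (i,j) = A $$ (j,i)"
    and i: "i < N"
  shows "(\<Sum>j<N. (cmod (evolution A t $$ (i,j)))\<^sup>2) = 1"
proof -
  define a where "a = \<i> * complex_of_real t"
  define c where "c s j k = (s * a) ^ k / of_nat (fact k) * complex_of_real ((A ^\<^sub>m k) $$ (i,j))" for s j k
  have U: "c 1 j sums (evolution A t $$ (i,j))" if "j < N" for j
    using evolution_sums[OF A i that, of t] by (simp add: c_def[abs_def] a_def)
  \<comment> \<open>The matrix is real and \<open>a\<close> is purely imaginary, so conjugation only
    replaces \<open>a\<close> by \<open>- a\<close>.\<close>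
  have "c (-1) j = (\<lambda>k. cnj (c 1 j k))" for j
    by (simp add: c_def a_def fun_eq_iff)
  then have V: "c (-1) j sums cnj (evolution A t $$ (i,j))" if "j < N" for j
    using U[OF that] by (simp add: sums_cnj)
  have nc: "summable (\<lambda>k. norm (c s j k))" if "j < N" for s j
    unfolding c_def by (rule summable_norm_evolution[OF A i that])
  have "(\<lambda>k. \<Sum>j<N. \<Sum>l\<le>k. c 1 j l * c (-1) j (k - l)) sums
      (\<Sum>j<N. evolution A t $$ (i,j) * cnj (evolution A t $$ (i,j)))"
  proof (intro sums_sum)
    fix j assume "j \<in> {..<N}"
    then have j: "j < N" by simp
    show "(\<lambda>k. \<Sum>l\<le>k. c 1 j l * c (-1) j (k - l)) sums
        (evolution A t $$ (i,j) * cnj (evolution A t $$ (i,j)))"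
      using Cauchy_product_sums[OF nc[OF j, of 1] nc[OF j, of "-1"]]
      by (simp add: sums_unique[OF U[OF j], symmetric] sums_unique[OF V[OF j], symmetric])
  qed
  moreover have "(\<Sum>j<N. \<Sum>l\<le>k. c 1 j l * c (-1) j (k - l)) = (if k = 0 then 1 else 0)" for k
  proof -
    have "(\<Sum>j<N. \<Sum>l\<le>k. c 1 j l * c (-1) j (k - l))
       = (\<Sum>l\<le>k. \<Sum>j<N. c 1 j l * c (-1) j (k - l))" by (rule sum.swap)
    also have "\<dots> = (\<Sum>l\<le>k. (a ^ l /\<^sub>R fact l) * ((- a) ^ (k - l) /\<^sub>R fact (k - l))
        * complex_of_real ((A ^\<^sub>m k) $$ (i,i)))"
    proof (rule sum.cong[OF refl])
      fix l assume "l \<in> {..k}"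
      then have "A ^\<^sub>m k = A ^\<^sub>m l * A ^\<^sub>m (k - l)"
        using pow_mat_add[OF A, of l "k - l"] by simp
      then have "(A ^\<^sub>m k) $$ (i,i) = (\<Sum>j<N. (A ^\<^sub>m l) $$ (i,j) * (A ^\<^sub>m (k - l)) $$ (j,i))"
        using index_mult_mat_sum[OF pow_carrier_mat[OF A] pow_carrier_mat[OF A] i i] by simp
      also have "\<dots> = (\<Sum>j<N. (A ^\<^sub>m l) $$ (i,j) * (A ^\<^sub>m (k - l)) $$ (i,j))"
        using pow_mat_symmetric[OF A sym i] by (intro sum.cong) auto
      finally show "(\<Sum>j<N. c 1 j l * c (-1) j (k - l)) =
          (a ^ l /\<^sub>R fact l) * ((- a) ^ (k - l) /\<^sub>R fact (k - l)) * complex_of_real ((A ^\<^sub>m k) $$ (i,i))"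
        by (simp add: c_def sum_distrib_left scaleR_conv_of_real field_simps)
    qed
    \<comment> \<open>The binomial theorem, in its form for divided powers.\<close>
    also have "\<dots> = (a + - a) ^ k /\<^sub>R fact k * complex_of_real ((A ^\<^sub>m k) $$ (i,i))"
      by (subst exp_series_add_commuting) (simp_all add: sum_distrib_right)
    also have "\<dots> = (if k = 0 then 1 else 0)" using A i by auto
    finally show ?thesis .
  qed
  ultimately have "(\<lambda>k. if k = 0 then 1 else 0) sums
      (\<Sum>j<N. evolution A t $$ (i,j) * cnj (evolution A t $$ (i,j)))"
    by simp
  moreover have "(\<lambda>k. if k = 0 then 1 else 0 :: complex) sums 1"
    using sums_single[of 0 "\<lambda>_. 1 :: complex"] by (simp add: eq_commute)
  ultimately have "(\<Sum>j<N. evolution A t $$ (i,j) * cnj (evolution A t $$ (i,j))) = 1"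
    by (rule sums_unique2)
  then have "complex_of_real (\<Sum>j<N. (cmod (evolution A t $$ (i,j)))\<^sup>2) = complex_of_real 1"
    by (simp only: of_real_sum complex_norm_square of_real_1)
  then show ?thesis by (simp only: of_real_eq_iff)
qed

text \<open>In a row of norm 1, an entry of modulus 1 forces all others to vanish, so applying the
  row to an eigenvector leaves one term.\<close>

lemma PST_eigenvector:
  assumes A: "A \<in> carrier_mat N N" and sym: "\<And>i j. i < N \<Longrightarrow> j < N \<Longrightarrow> A $$ (i,j) = A $$ (j,i)"
    and u: "u < N" and w: "w < N" and "PST A u w t"
    and eig: "\<And>i. i < N \<Longrightarrow> (\<Sum>j<N. complex_of_real (A $$ (i,j)) * v j) = x * v i"
  shows "evolution A t $$ (u,w) * v w = exp (\<i> * complex_of_real t * x) * v u"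
proof -
  have "(\<Sum>j\<in>{..<N} - {w}. (cmod (evolution A t $$ (u,j)))\<^sup>2) = 0"
    using evolution_row_norm[OF A sym u, of t] assms(5) w
    by (simp add: PST_def sum.remove[of "{..<N}" w])
  then have "evolution A t $$ (u,j) = 0" if "j \<in> {..<N} - {w}" for j
    using that by (subst (asm) sum_nonneg_eq_0_iff) auto
  then have "(\<Sum>j<N. evolution A t $$ (u,j) * v j) = evolution A t $$ (u,w) * v w"
    using w by (simp add: sum.remove[of "{..<N}" w])
  then show ?thesis
    using evolution_eigenvector[OF A eig u, of t] by simp
qed

section \<open>Roots of monic complex polynomials\<close>

lemma monic_complex_poly_decompose:
  assumes "lead_coeff (p :: complex poly) = 1"
  shows "(\<Prod>x\<in>#proots p. [:-x, 1:]) = p"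
  using complex_poly_decompose_multiset[of p] assms by simp

lemma poly_monic_complex:
  assumes "lead_coeff (p :: complex poly) = 1"
  shows "poly p a = (\<Prod>b\<in>#proots p. a - b)"
proof -
  have "poly (\<Prod>x\<in>#M. [:-x, 1:]) a = (\<Prod>b\<in>#M. a - b)" for M :: "complex multiset"
    by (induction M) (auto simp: left_diff_distrib)
  from this[of "proots p"] show ?thesis
    by (simp only: monic_complex_poly_decompose[OF assms])
qed

lemma norm_prod_mset: "norm (\<Prod>x\<in>#M. f x) = (\<Prod>x\<in>#M. norm (f x :: complex))"
  by (induction M) (auto simp: norm_mult)

text \<open>Both sides are the product of \<open>norm (a - b)\<close> over all pairs of roots, the
  absolute value of the resultant; the norm absorbs the sign of the exchange.\<close>

lemma norm_resultant_commute:
  assumes "lead_coeff (p :: complex poly) = 1" "lead_coeff q = 1"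
  shows "norm (\<Prod>a\<in>#proots p. poly q a) = norm (\<Prod>b\<in>#proots q. poly p b)"
proof -
  have swap: "(\<Prod>a\<in>#A. \<Prod>b\<in>#B. norm (a - b)) = (\<Prod>b\<in>#B. \<Prod>a\<in>#A. norm (b - a))"
    for A B :: "complex multiset"
  proof (induction A)
    case empty
    then show ?case by simp
  next
    case (add x A)
    then show ?case by (simp add: prod_mset.distrib norm_minus_commute)
  qed
  show ?thesis
    by (simp add: poly_monic_complex[OF assms(1)] poly_monic_complex[OF assms(2)] norm_prod_mset swap)
qed

text \<open>Vieta's formula for the second-highest coefficient.\<close>

lemma sum_proots:
  assumes "lead_coeff (p :: complex poly) = 1" "degree p = Suc m"
  shows "(\<Sum>x\<in>#proots p. x) = - coeff p m"
proof -
  \<comment> \<open>Multiplying by a new linear factor brings the leading coefficient of the old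
    product into the second-highest one, so it must be known to be 1.\<close>
  have lin: "degree (\<Prod>x\<in>#M. [:-x, 1:]) = size M \<and> lead_coeff (\<Prod>x\<in>#M. [:-x, 1:]) = 1"
    for M :: "complex multiset"
  proof (induction M)
    case empty
    then show ?case by simp
  next
    case (add x M)
    then have "(\<Prod>x\<in>#M. [:-x, 1:]) \<noteq> 0" by auto
    then have "degree ([:-x, 1:] * (\<Prod>x\<in>#M. [:-x, 1:])) = Suc (size M)"
      using add by (subst degree_mult_eq) auto
    moreover have "lead_coeff ([:-x, 1:] * (\<Prod>x\<in>#M. [:-x, 1:])) = 1"
      using add by (subst lead_coeff_mult) auto
    ultimately show ?case by simp
  qed
  have "coeff (\<Prod>x\<in>#M. [:-x, 1:]) m = - (\<Sum>x\<in>#M. x)" if "size M = Suc m"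
    for M :: "complex multiset" and m
    using that
  proof (induction M arbitrary: m)
    case empty
    then show ?case by simp
  next
    case (add x M)
    then have "coeff (\<Prod>x\<in>#M. [:-x, 1:]) m = 1"
      using lin[of M] by (metis add_left_cancel plus_1_eq_Suc size_add_mset)
    then show ?case using add by (cases m) (auto simp: coeff_pCons)
  qed
  from this[of "proots p" m] show ?thesis
    by (simp add: size_proots_complex assms(2) monic_complex_poly_decompose[OF assms(1)])
qed

section \<open>Characteristic polynomials of initial segments of the path\<close>

text \<open>For \<open>k \<le> n\<close> this is the characteristic polynomial of the leading
  \<open>k\<close> by \<open>k\<close> block of the Hamiltonian, expanded along its last row; the
  diagonal entries are \<open>- q i\<close>, hence the plus sign.\<close>

fun path_poly :: "(nat \<Rightarrow> real) \<Rightarrow> nat \<Rightarrow> complex poly" where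
  "path_poly q 0 = 1"
| "path_poly q (Suc 0) = [:complex_of_real (q 0), 1:]"
| "path_poly q (Suc (Suc k)) =
     [:complex_of_real (q (Suc k)), 1:] * path_poly q (Suc k) - path_poly q k"

lemma monic_add_lower:
  assumes "lead_coeff (p :: complex poly) = 1" "degree r < degree p"
  shows "lead_coeff (p + r) = 1" "degree (p + r) = degree p"
  using assms by (simp_all add: degree_add_eq_left coeff_eq_0)

lemma path_poly_monic: "degree (path_poly q k) = k \<and> lead_coeff (path_poly q k) = 1"
proof (induction q k rule: path_poly.induct)
  case (3 q k)
  let ?p = "[:complex_of_real (q (Suc k)), 1:] * path_poly q (Suc k)"
  have nz: "path_poly q (Suc k) \<noteq> 0" using 3 by auto
  then have deg: "degree ?p = Suc (Suc k)" using 3 by (subst degree_mult_eq) auto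
  have lc: "lead_coeff ?p = 1" using 3 by (subst lead_coeff_mult) auto
  show ?case
    using monic_add_lower[OF lc, of "- path_poly q k"] 3 deg by simp
qed auto

lemma degree_path_poly [simp]: "degree (path_poly q k) = k"
  and lead_coeff_path_poly: "lead_coeff (path_poly q k) = 1"
  using path_poly_monic by blast+

text \<open>By the recurrence and commutativity of resultants up to sign, the resultant of consecutive
  terms does not depend on the index.\<close>

lemma norm_resultant_path_poly:
  "norm (\<Prod>a\<in>#proots (path_poly q (Suc k)). poly (path_poly q k) a) = 1"
proof (induction k)
  case 0
  then show ?case by (simp add: image_mset_const_eq)
next
  case (Suc k)
  have "norm (\<Prod>a\<in>#proots (path_poly q (Suc (Suc k))). poly (path_poly q (Suc k)) a)
      = norm (\<Prod>b\<in>#proots (path_poly q (Suc k)). poly (path_poly q (Suc (Suc k))) b)"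
    by (rule norm_resultant_commute) (rule lead_coeff_path_poly)+
  also have "\<dots> = (\<Prod>b\<in>#proots (path_poly q (Suc k)). norm (poly (path_poly q k) b))"
    unfolding norm_prod_mset
  proof (intro arg_cong[of _ _ prod_mset] image_mset_cong)
    \<comment> \<open>At a root of the middle term the recurrence reduces to minus the lowest
      term.\<close>
    fix b assume "b \<in># proots (path_poly q (Suc k))"
    moreover have "path_poly q (Suc k) \<noteq> 0"
      using lead_coeff_path_poly[of q "Suc k"] by auto
    ultimately have "poly (path_poly q (Suc k)) b = 0" by simp
    then show "norm (poly (path_poly q (Suc (Suc k))) b) = norm (poly (path_poly q k) b)"
      by simp
  qed
  finally show ?case using Suc by (simp add: norm_prod_mset)
qed

text \<open>For \<open>s\<close> equal to 1 or -1 and \<open>n = Suc m\<close>, this is the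
  characteristic polynomial of the Hamiltonian on mirror-symmetric or antisymmetric vectors: folding
  the path adds \<open>s\<close> to the last diagonal entry of the half block.\<close>

definition parity_poly :: "(nat \<Rightarrow> real) \<Rightarrow> nat \<Rightarrow> complex \<Rightarrow> complex poly" where
  "parity_poly q m s = path_poly q (Suc m) - smult s (path_poly q m)"

lemma parity_poly_monic:
  "degree (parity_poly q m s) = Suc m" "lead_coeff (parity_poly q m s) = 1"
proof -
  have "degree (smult s (path_poly q m)) < Suc m"
    using degree_smult_le[of s "path_poly q m"] by simp
  then show "degree (parity_poly q m s) = Suc m" "lead_coeff (parity_poly q m s) = 1"
    using monic_add_lower[OF lead_coeff_path_poly[of q "Suc m"], of "- smult s (path_poly q m)"]
    by (simp_all add: parity_poly_def)
qed

lemma parity_poly_root: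
  "x \<in># proots (parity_poly q m s) \<longleftrightarrow> poly (path_poly q (Suc m)) x = s * poly (path_poly q m) x"
proof -
  have "parity_poly q m s \<noteq> 0" using parity_poly_monic(2)[of q m s] by auto
  then show ?thesis by (simp add: parity_poly_def)
qed

text \<open>At a root of one parity polynomial the other equals twice \<open>path_poly q m\<close>,
  giving one factor 2 per root. What remains is the resultant with \<open>path_poly q m\<close>, and
  subtracting \<open>path_poly q m\<close> does not change values at its own roots, so consecutive
  path polynomials are left.\<close>

lemma norm_prod_parity_roots:
  "norm (\<Prod>x\<in>#proots (parity_poly q m 1). \<Prod>y\<in>#proots (parity_poly q m (-1)). x - y) = 2 ^ Suc m"
proof -
  let ?M = "proots (parity_poly q m 1)"
  have "norm (\<Prod>x\<in>#?M. \<Prod>y\<in>#proots (parity_poly q m (-1)). x - y)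
      = (\<Prod>x\<in>#?M. norm (poly (parity_poly q m (-1)) x))"
    by (simp add: poly_monic_complex[OF parity_poly_monic(2)] norm_prod_mset)
  also have "\<dots> = (\<Prod>x\<in>#?M. 2 * norm (poly (path_poly q m) x))"
  proof (intro arg_cong[of _ _ prod_mset] image_mset_cong)
    fix x assume "x \<in># ?M"
    then have "poly (parity_poly q m (-1)) x = 2 * poly (path_poly q m) x"
      using parity_poly_root[of x q m 1] by (simp add: parity_poly_def)
    then show "norm (poly (parity_poly q m (-1)) x) = 2 * norm (poly (path_poly q m) x)"
      by (simp add: norm_mult)
  qed
  also have "\<dots> = 2 ^ Suc m * norm (\<Prod>x\<in>#?M. poly (path_poly q m) x)"
    by (simp add: prod_mset.distrib norm_prod_mset prod_mset_constant image_mset_const_eq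
        size_proots_complex parity_poly_monic)
  also have "norm (\<Prod>x\<in>#?M. poly (path_poly q m) x)
      = norm (\<Prod>b\<in>#proots (path_poly q m). poly (parity_poly q m 1) b)"
    by (rule norm_resultant_commute[OF parity_poly_monic(2) lead_coeff_path_poly])
  also have "(\<Prod>b\<in>#proots (path_poly q m). poly (parity_poly q m 1) b)
      = (\<Prod>b\<in>#proots (path_poly q m). poly (path_poly q (Suc m)) b)"
  proof (intro arg_cong[of _ _ prod_mset] image_mset_cong)
    fix b assume "b \<in># proots (path_poly q m)"
    moreover have "path_poly q m \<noteq> 0" using lead_coeff_path_poly[of q m] by auto
    ultimately have "poly (path_poly q m) b = 0" by simp
    then show "poly (parity_poly q m 1) b = poly (path_poly q (Suc m)) b"
      by (simp add: parity_poly_def)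
  qed
  also have "norm \<dots> = norm (\<Prod>a\<in>#proots (path_poly q (Suc m)). poly (path_poly q m) a)"
    by (rule norm_resultant_commute) (rule lead_coeff_path_poly)+
  also have "\<dots> = 1" by (rule norm_resultant_path_poly)
  finally show ?thesis by simp
qed

text \<open>The monic \<open>path_poly q m\<close> enters the two polynomials with opposite signs,
  so their coefficients at degree \<open>m\<close> differ by 2.\<close>

lemma sum_parity_roots:
  "(\<Sum>x\<in>#proots (parity_poly q m 1). x) - (\<Sum>y\<in>#proots (parity_poly q m (-1)). y) = 2"
proof -
  have "coeff (path_poly q m) m = 1" using lead_coeff_path_poly[of q m] by simp
  then show ?thesis
    by (simp only: sum_proots[OF parity_poly_monic(2,1)]) (simp add: parity_poly_def)
qed

section \<open>Eigenvectors of the Hamiltonian\<close>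

lemma hamiltonian_carrier: "hamiltonian n q \<in> carrier_mat (2*n) (2*n)"
  by (auto simp: hamiltonian_def path_adj_def sym_potential_def intro!: minus_carrier_mat)

lemma hamiltonian_entry:
  assumes "i < 2*n" "j < 2*n"
  shows "hamiltonian n q $$ (i,j) =
    (if i + 1 = j \<or> j + 1 = i then 1 else 0) - (if i = j then q (min i (2*n - 1 - i)) else 0)"
  using assms by (simp add: hamiltonian_def path_adj_def sym_potential_def)

lemma hamiltonian_sym:
  "i < 2*n \<Longrightarrow> j < 2*n \<Longrightarrow> hamiltonian n q $$ (i,j) = hamiltonian n q $$ (j,i)"
  by (auto simp: hamiltonian_entry)

lemma hamiltonian_apply:
  assumes "i < 2*n"
  shows "(\<Sum>j<2*n. complex_of_real (hamiltonian n q $$ (i,j)) * v j) =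
    (if i + 1 < 2*n then v (i + 1) else 0) + (if 0 < i then v (i - 1) else 0)
      - complex_of_real (q (min i (2*n - 1 - i))) * v i"
proof -
  let ?d = "complex_of_real (q (min i (2*n - 1 - i)))"
  \<comment> \<open>For \<open>i = 0\<close> truncated subtraction makes \<open>i - 1\<close> equal
    to \<open>i\<close>; the guard \<open>0 < i\<close> removes this spurious neighbour.\<close>
  have "complex_of_real (hamiltonian n q $$ (i,j)) * v j =
      (if j = i + 1 then v j else 0) + (if j = i - 1 then if 0 < i then v j else 0 else 0)
        - (if j = i then ?d * v j else 0)" if "j < 2*n" for j
  proof -
    consider "j = i + 1" | "j + 1 = i" | "j = i" | "j \<noteq> i + 1" "j + 1 \<noteq> i" "j \<noteq> i" by blast
    then show ?thesis
      using hamiltonian_entry[OF assms that, of q] by cases auto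
  qed
  then have "(\<Sum>j<2*n. complex_of_real (hamiltonian n q $$ (i,j)) * v j) =
      (\<Sum>j<2*n. if j = i + 1 then v j else 0)
        + (\<Sum>j<2*n. if j = i - 1 then if 0 < i then v j else 0 else 0)
        - (\<Sum>j<2*n. if j = i then ?d * v j else 0)"
    by (simp add: sum.distrib sum_subtractf)
  moreover have "i - 1 < 2*n" using assms by simp
  ultimately show ?thesis
    using assms by (simp only: sum.delta finite_lessThan lessThan_iff if_True)
qed

text \<open>The left half solves the eigenvalue recurrence starting from 1; the right half is its
  mirror image times \<open>s\<close>.\<close>

definition parity_vec :: "(nat \<Rightarrow> real) \<Rightarrow> nat \<Rightarrow> complex \<Rightarrow> complex \<Rightarrow> nat \<Rightarrow> complex" where
  "parity_vec q n s x k =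
     (if k < n then poly (path_poly q k) x else s * poly (path_poly q (2*n - 1 - k)) x)"

text \<open>The recurrence in the shape of a row of the eigenvalue equation, with the missing
  neighbour of the end vertex counted as 0.\<close>

lemma path_poly_step:
  "poly (path_poly q (k + 1)) x + (if 0 < k then poly (path_poly q (k - 1)) x else 0)
     = (x + complex_of_real (q k)) * poly (path_poly q k) x"
  by (cases k) (auto simp: algebra_simps)

lemma parity_vec_reflect:
  assumes "s * s = 1" "k < 2*n"
  shows "parity_vec q n s x (2*n - 1 - k) = s * parity_vec q n s x k"
proof (cases "k < n")
  case True
  then show ?thesis by (simp add: parity_vec_def)
next
  case False
  then show ?thesis using assms by (simp add: parity_vec_def mult.assoc[symmetric])
qed

text \<open>Left rows are the path recurrence, right rows follow by reflection, and the root
  condition matches the halves across the middle edge.\<close>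

lemma parity_vec_eigen:
  assumes root: "x \<in># proots (parity_poly q m s)" and s: "s * s = 1" and i: "i < 2 * Suc m"
  defines "n \<equiv> Suc m"
  shows "(\<Sum>j<2*n. complex_of_real (hamiltonian n q $$ (i,j)) * parity_vec q n s x j)
    = x * parity_vec q n s x i"
proof -
  let ?v = "parity_vec q n s x"
  let ?H = "\<lambda>i. (if i + 1 < 2*n then ?v (i + 1) else 0) + (if 0 < i then ?v (i - 1) else 0)
      - complex_of_real (q (min i (2*n - 1 - i))) * ?v i"
  have root': "poly (path_poly q n) x = s * poly (path_poly q m) x"
    using root by (simp add: parity_poly_root n_def)
  have left: "?H i = x * ?v i" if "i < n" for i
  proof -
    \<comment> \<open>At \<open>i = m\<close> the next entry already lies in the right half; the
      root condition makes it continue the recurrence.\<close>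
    have "?v (i + 1) = poly (path_poly q (i + 1)) x"
    proof (cases "i + 1 < n")
      case True
      then show ?thesis by (simp add: parity_vec_def)
    next
      case False
      then have "i = m" using that by (simp add: n_def)
      then show ?thesis using root' by (simp add: parity_vec_def n_def)
    qed
    moreover have "min i (2*n - 1 - i) = i" "i + 1 < 2*n" using that by (auto simp: n_def)
    ultimately have "?H i = poly (path_poly q (i + 1)) x + (if 0 < i then poly (path_poly q (i - 1)) x else 0)
      - complex_of_real (q i) * poly (path_poly q i) x"
      using that by (simp add: parity_vec_def)
    also have "\<dots> = x * poly (path_poly q i) x"
      unfolding path_poly_step by (simp add: algebra_simps)
    finally show ?thesis using that by (simp add: parity_vec_def)
  qed
  have "?H i = x * ?v i"
  proof (cases "i < n")
    case True
    then show ?thesis by (rule left)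
  next
    case False
    \<comment> \<open>\<open>k\<close> is the mirror image of \<open>i\<close>. Reflection swaps the
      two neighbours and preserves the potential, so row \<open>i\<close> is \<open>s\<close> times
      row \<open>k\<close>.\<close>
    define k where "k = 2*n - 1 - i"
    have k: "k < n" "i = 2*n - 1 - k" using False i by (auto simp: k_def n_def)
    have vi: "?v i = s * ?v k" using parity_vec_reflect[OF s, of k n q x] k by simp
    have "?v (i - 1) = s * ?v (k + 1)" "0 < i"
      using parity_vec_reflect[OF s, of "k + 1" n q x] k by (simp_all add: n_def)
    moreover have "?v (i + 1) = s * ?v (k - 1)" if "0 < k"
    proof -
      have "2*n - 1 - (k - 1) = i + 1" "k - 1 < 2*n" using k that by auto
      then show ?thesis using parity_vec_reflect[OF s, of "k - 1" n q x] by (simp only:)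
    qed
    moreover have "i + 1 < 2*n \<longleftrightarrow> 0 < k" "k + 1 < 2 * n" "min i (2*n - 1 - i) = min k (2*n - 1 - k)"
      using k by auto
    ultimately have "?H i = s * ?H k" by (auto simp: vi algebra_simps)
    also have "\<dots> = x * ?v i" unfolding left[OF k(1)] vi by (rule mult.left_commute)
    finally show ?thesis .
  qed
  then show ?thesis
    using hamiltonian_apply[of i n q ?v] i by (simp add: n_def)
qed

text \<open>The end entries of \<open>parity_vec\<close> are 1 and \<open>s\<close>.\<close>

lemma exp_parity_root:
  assumes "PST (hamiltonian (Suc m) q) 0 (2 * Suc m - 1) t"
    and "x \<in># proots (parity_poly q m s)" "s * s = 1"
  shows "exp (\<i> * complex_of_real t * x)
    = s * evolution (hamiltonian (Suc m) q) t $$ (0, 2 * Suc m - 1)"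
  using PST_eigenvector[OF hamiltonian_carrier hamiltonian_sym _ _ assms(1)
      parity_vec_eigen[OF assms(2,3)]]
  by (simp add: parity_vec_def mult.commute)

section \<open>The arithmetic contradiction\<close>

text \<open>As the sizes agree, the elements can be paired off arbitrarily.\<close>

lemma sum_mset_diff_multiple:
  fixes A B :: "complex multiset"
  assumes "size A = size B" "\<And>x y. x \<in># A \<Longrightarrow> y \<in># B \<Longrightarrow> \<exists>k::int. x - y = c * of_int k"
  shows "\<exists>k::int. (\<Sum>x\<in>#A. x) - (\<Sum>y\<in>#B. y) = c * of_int k"
  using assms
proof (induction A arbitrary: B)
  case empty
  then show ?case by (auto intro: exI[of _ 0])
next
  case (add x A)
  then obtain y B' where B: "B = add_mset y B'" by (cases B) auto
  obtain k :: int where "(\<Sum>x\<in>#A. x) - (\<Sum>y\<in>#B'. y) = c * of_int k"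
    using add.IH[of B'] add.prems B by auto
  moreover obtain l :: int where "x - y = c * of_int l"
    using add.prems(2)[of x y] B by auto
  ultimately have "(\<Sum>x\<in>#add_mset x A. x) - (\<Sum>y\<in>#B. y) = c * of_int (l + k)"
    by (simp add: B algebra_simps)
  then show ?case by blast
qed

lemma prod_mset_odd_multiple:
  fixes f :: "'a \<Rightarrow> complex"
  assumes "\<And>x. x \<in># M \<Longrightarrow> \<exists>k::int. odd k \<and> f x = c * of_int k"
  shows "\<exists>k::int. odd k \<and> (\<Prod>x\<in>#M. f x) = c ^ size M * of_int k"
  using assms
proof (induction M)
  case empty
  then show ?case by (auto intro: exI[of _ 1])
next
  case (add x M)
  obtain k l :: int where "odd k" "(\<Prod>x\<in>#M. f x) = c ^ size M * of_int k"
      "odd l" "f x = c * of_int l"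
    using add by (metis insert_iff set_mset_add_mset_insert)
  then have "odd (k * l) \<and> (\<Prod>x\<in>#add_mset x M. f x) = c ^ size (add_mset x M) * of_int (k * l)"
    by (simp add: algebra_simps)
  then show ?case by blast
qed

lemma exp_eq_minus_one_imp:
  assumes "exp (\<i> * complex_of_real t * z) = -1"
  shows "\<exists>k::int. odd k \<and> z = complex_of_real (pi / t) * of_int k"
proof -
  \<comment> \<open>At \<open>t = 0\<close> the exponential would be 1; this justifies dividing by
    \<open>t\<close>.\<close>
  have "t \<noteq> 0" using assms by (auto simp: complex_eq_iff)
  have "exp (\<i> * complex_of_real t * z) = exp (\<i> * of_real pi)" using assms by simp
  then obtain k :: int where "\<i> * complex_of_real t * z = \<i> * of_real pi + (of_int (2 * k) * pi) * \<i>"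
    unfolding exp_eq by auto
  then have "\<i> * (complex_of_real t * z) = \<i> * (of_real pi * of_int (2 * k + 1))"
    by (simp add: algebra_simps)
  then have "complex_of_real t * z = of_real pi * of_int (2 * k + 1)" by simp
  then have "z = complex_of_real (pi / t) * of_int (2 * k + 1)"
    using \<open>t \<noteq> 0\<close> by (simp add: field_simps)
  then show ?thesis by (metis dvd_triv_left odd_add odd_one)
qed

text \<open>Compare the exponents of 2: \<open>n\<^sup>2 = n + n\<^sup>2 v\<close>, where \<open>v\<close> is the exponent of 2 in \<open>k\<close>.\<close>

lemma two_power_obstruction:
  fixes j k :: nat
  assumes "odd j" "2 ^ (n * n) * j = 2 ^ n * k ^ (n * n)" "n \<ge> 2"
  shows False
proof -
  have "j > 0" using assms(1) by (cases j) auto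
  then have "2 ^ n * k ^ (n * n) > 0" using assms(2)[symmetric] by simp
  \<comment> \<open>The product and power laws for multiplicities need nonzero factors.\<close>
  then have k: "k > 0" using assms(3) by (cases k) (auto simp: power_0_left)
  have "multiplicity 2 (2 ^ (n * n) * j) = n * n"
    using \<open>j > 0\<close> assms(1) by (simp add: prime_elem_multiplicity_mult_distrib not_dvd_imp_multiplicity_0)
  moreover have "multiplicity 2 (2 ^ n * k ^ (n * n)) = n + n * n * multiplicity 2 k"
    using k by (simp add: prime_elem_multiplicity_mult_distrib prime_elem_multiplicity_power_distrib)
  ultimately have "n * n = n * (1 + n * multiplicity 2 k)"
    using assms(2) by (simp add: algebra_simps)
  then have "n = 1 + n * multiplicity 2 k" using assms(3) by (simp only: mult_cancel1) simp
  \<comment> \<open>For \<open>n = 1\<close> exponent 0 would solve the equation, and the two-vertex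
    path does admit transfer.\<close>
  then have "n dvd 1" by (metis dvd_add_left_iff dvd_refl dvd_triv_left)
  then show False using assms(3) by simp
qed

theorem theorem4:
  fixes n :: nat and q :: "nat \<Rightarrow> real"
  assumes "n \<ge> 2"
  shows "\<not> (\<exists>T::real. PST (hamiltonian n q) 0 (2*n - 1) T)"
proof
  assume "\<exists>T::real. PST (hamiltonian n q) 0 (2*n - 1) T"
  then obtain t where PST: "PST (hamiltonian n q) 0 (2*n - 1) t" by blast
  obtain m where n: "n = Suc m" using assms by (cases n) auto
  define \<gamma> where "\<gamma> = evolution (hamiltonian n q) t $$ (0, 2*n - 1)"
  have "\<gamma> \<noteq> 0" using PST by (auto simp: PST_def \<gamma>_def)
  define A where "A = proots (parity_poly q m 1)"
  define B where "B = proots (parity_poly q m (-1))"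
  have size: "size A = n" "size B = n"
    by (simp_all add: A_def B_def n size_proots_complex parity_poly_monic)
  define c where "c = complex_of_real (pi / t)"
  have diff: "\<exists>k::int. odd k \<and> x - y = c * of_int k" if "x \<in># A" "y \<in># B" for x y
    unfolding c_def
  proof (rule exp_eq_minus_one_imp)
    have "exp (\<i> * complex_of_real t * x) = \<gamma>" "exp (\<i> * complex_of_real t * y) = - \<gamma>"
      using exp_parity_root[of m q t x 1] exp_parity_root[of m q t y "-1"] PST that
      by (simp_all add: A_def B_def n \<gamma>_def)
    then show "exp (\<i> * complex_of_real t * (x - y)) = -1"
      using \<open>\<gamma> \<noteq> 0\<close> by (simp add: right_diff_distrib exp_diff)
  qed
  \<comment> \<open>Odd multiples are multiplied twice: over \<open>B\<close> they give an odd
    multiple of \<open>c ^ n\<close>, then over \<open>A\<close> one of its \<open>n\<close>-th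
    power.\<close>
  have "\<exists>k::int. odd k \<and> (\<Prod>x\<in>#A. \<Prod>y\<in>#B. x - y) = (c ^ n) ^ size A * of_int k"
  proof (rule prod_mset_odd_multiple)
    fix x assume "x \<in># A"
    then show "\<exists>k::int. odd k \<and> (\<Prod>y\<in>#B. x - y) = c ^ n * of_int k"
      using prod_mset_odd_multiple[of B "\<lambda>y. x - y" c] diff by (simp add: size)
  qed
  then obtain j :: int where j: "odd j" "(\<Prod>x\<in>#A. \<Prod>y\<in>#B. x - y) = c ^ (n * n) * of_int j"
    by (auto simp: size power_mult)
  obtain k :: int where k: "2 = c * of_int k"
    using sum_mset_diff_multiple[of A B c] sum_parity_roots[of q m] diff
    by (metis A_def B_def size)
  have "norm (c ^ (n * n) * of_int j) = 2 ^ n"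
    using norm_prod_parity_roots[of q m] by (simp add: j(2) A_def[symmetric] B_def[symmetric] n)
  \<comment> \<open>Norms remove the unknown signs, including that of \<open>t\<close>.\<close>
  then have prod: "norm c ^ (n * n) * \<bar>real_of_int j\<bar> = 2 ^ n"
    by (simp add: norm_mult norm_power)
  have sum: "2 = norm c * \<bar>real_of_int k\<bar>"
    using arg_cong[OF k, of norm] by (simp add: norm_mult)
  \<comment> \<open>Raising \<open>sum\<close> to the power \<open>n * n\<close> and inserting
    \<open>prod\<close> eliminates \<open>c\<close>, leaving an equation between integers.\<close>
  have "2 ^ (n * n) * \<bar>real_of_int j\<bar> = norm c ^ (n * n) * \<bar>real_of_int j\<bar> * \<bar>real_of_int k\<bar> ^ (n * n)"
    by (subst sum) (simp only: power_mult_distrib mult_ac)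
  also have "\<dots> = 2 ^ n * \<bar>real_of_int k\<bar> ^ (n * n)" by (simp only: prod)
  finally have "real (2 ^ (n * n) * nat \<bar>j\<bar>) = real (2 ^ n * nat \<bar>k\<bar> ^ (n * n))"
    by simp
  then have "2 ^ (n * n) * nat \<bar>j\<bar> = 2 ^ n * nat \<bar>k\<bar> ^ (n * n)"
    by (simp only: of_nat_eq_iff)
  moreover have "odd (nat \<bar>j\<bar>)" using j(1) by (simp add: even_nat_iff)
  ultimately show False using two_power_obstruction assms by blast
qed

end
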